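(* Let $\mathbf p=(p_1,\dots,p_r)$ and $\mathbf q=(q_1,\dots,q_r)$ be probability distributions on $\mathcal X=\{c_1,\dots,c_r\}$ with $p_j>0$ and $q_j>0$ for all $j\in D$. Let $\widehat{\mathbf p}_n$ and $\widehat{\mathbf q}_m$ be the empirical distributions of i.i.d. samples $X_1,\dots,X_n$ from $\mathbf p$ and $Y_1,\dots,Y_m$ from $\mathbf q$. Put $$A_{KL,1}(\mathbf p,\mathbf q)=\sum_{j\in D}|1+\log(p_j/q_j)|,\qquad A_{KL,2}(\mathbf p,\mathbf q)=\sum_{j\in D}p_j/q_j.$$ Then: (a) (One sample) $$\limsup_{n\to+\infty}\frac{|\mathcal D_{KL}(\widehat{\mathbf p}_n,\mathbf q)-\mathcal D_{KL}(\mathbf p,\mathbf q)|}{a_n}\le A_{KL,1}(\mathbf p,\mathbf q)\quad\text{a.s.},\qquad\limsup_{n\to+\infty}\frac{|\mathcal D_{KL}(\mathbf p,\widehat{\mathbf q}_n)-\mathcal D_{KL}(\mathbf p,\mathbf q)|}{b_n}\le A_{KL,2}(\mathbf p,\mathbf q)\quad\text{a.s.}$$ (b) (Two samples) $$\limsup_{(n,m)\to(+\infty,+\infty)}\frac{|\mathcal D_{KL}(\widehat{\mathbf p}_n,\widehat{\mathbf q}_m)-\mathcal D_{KL}(\mathbf p,\mathbf q)|}{c_{n,m}}\le A_{KL,1}(\mathbf p,\mathbf q)+A_{KL,2}(\mathbf p,\mathbf q)\quad\text{a.s.}$$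
   Context: $\mathcal X=\{c_1,\dots,c_r\}$ with $r\ge 2$ is a finite set of distinct points and $D=\{1,\dots,r\}$. A probability distribution $\mathbf p$ on $\mathcal X$ is identified with the vector $(p_1,\dots,p_r)$, $p_j$ being the mass of $c_j$. $X_1,X_2,\dots$ are i.i.d. with $\mathbb P(X_i=c_j)=p_j$, and $Y_1,Y_2,\dots$ are i.i.d. with $\mathbb P(Y_i=c_j)=q_j$; the two sequences are independent of each other. Empirical probabilities: $\widehat p_n^{c_j}=\frac1n\sum_{i=1}^n 1_{\{X_i=c_j\}}$, $\widehat q_m^{c_j}=\frac1m\sum_{i=1}^m 1_{\{Y_i=c_j\}}$, $\widehat{\mathbf p}_n=(\widehat p_n^{c_j})_{j\in D}$, $\widehat{\mathbf q}_m=(\widehat q_m^{c_j})_{j\in D}$. $a_n=\sup_{j\in D}|\widehat p_n^{c_j}-p_j|$, $b_m=\sup_{j\in D}|\widehat q_m^{c_j}-q_j|$, $c_{n,m}=\max(a_n,b_m)$. Kullback-Leibler divergence: $\mathcal D_{KL}(\mathbf p,\mathbf q)=\sum_{j\in D}p_j\log(p_j/q_j)$ (natural logarithm). Conventions: a ratio $0/0$ of a difference by $a_n$, $b_n$ or $c_{n,m}$ is read as $0$; if an empirical divergence is undefined because some empirical probability vanishes, it is given the value $0$; $\limsup_{(n,m)\to(+\infty,+\infty)}x_{n,m}=\lim_{N\to\infty}\sup_{n,m\ge N}x_{n,m}$. *)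

theory Defs
  imports "HOL-Probability.Probability"
begin

text \<open>
  Vectors \<open>(u\<^sub>1, \<dots>, u\<^sub>r)\<close> are functions \<open>nat \<Rightarrow> real\<close> of which only the
  values on \<open>{1..r}\<close> matter.
\<close>

definition prob_vector :: "nat \<Rightarrow> (nat \<Rightarrow> real) \<Rightarrow> bool" where
  "prob_vector r p \<longleftrightarrow> (\<forall>j\<in>{1..r}. 0 \<le> p j) \<and> (\<Sum>j=1..r. p j) = 1"

text \<open>
  The logarithms are undefined as soon as some \<open>p j\<close> or \<open>q j\<close> vanishes; the value is then
  set to \<open>0\<close>. This branch is relevant for empirical distributions only.
\<close>

definition kl_div :: "nat \<Rightarrow> (nat \<Rightarrow> real) \<Rightarrow> (nat \<Rightarrow> real) \<Rightarrow> real" where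
  "kl_div r p q =
    (if \<forall>j\<in>{1..r}. p j > 0 \<and> q j > 0 then \<Sum>j=1..r. p j * ln (p j / q j) else 0)"

text \<open>
  On positive vectors this is the divergence of the library, in which the reference measure
  is the first argument.
\<close>

lemma kl_div_eq_KL_divergence:
  assumes "\<And>j. j \<in> {1..r} \<Longrightarrow> p j > 0" "\<And>j. j \<in> {1..r} \<Longrightarrow> q j > 0"
  shows "kl_div r p q =
    KL_divergence (exp 1) (point_measure {1..r} q) (point_measure {1..r} p)"
proof -
  interpret sigma_finite_measure "count_space {1..r}"
    by (rule sigma_finite_measure_count_space_finite) simp
  have "1 < exp (1::real)" by simp
  then have "KL_divergence (exp 1) (density (count_space {1..r}) (\<lambda>x. ennreal (q x)))
      (density (count_space {1..r}) (\<lambda>x. ennreal (p x)))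
      = (\<integral>x. p x * log (exp 1) (p x / q x) \<partial>count_space {1..r})"
    by (rule KL_density_density) (use assms in \<open>force simp: AE_count_space less_imp_le\<close>)+
  also have "\<dots> = (\<Sum>j=1..r. p j * ln (p j / q j))"
    by (simp add: lebesgue_integral_count_space_finite log_def)
  finally show ?thesis
    using assms by (simp add: kl_div_def point_measure_def)
qed

definition emp_prob :: "(nat \<Rightarrow> 'a) \<Rightarrow> (nat \<Rightarrow> 'w \<Rightarrow> 'a) \<Rightarrow> nat \<Rightarrow> 'w \<Rightarrow> nat \<Rightarrow> real" where
  "emp_prob c X n \<omega> j = 1 / real n * (\<Sum>i=1..n. indicator {\<omega>'. X i \<omega>' = c j} \<omega>)"

definition sup_dev :: "nat \<Rightarrow> (nat \<Rightarrow> real) \<Rightarrow> (nat \<Rightarrow> real) \<Rightarrow> real" where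
  "sup_dev r u v = (SUP j\<in>{1..r}. \<bar>u j - v j\<bar>)"

definition A_KL1 :: "nat \<Rightarrow> (nat \<Rightarrow> real) \<Rightarrow> (nat \<Rightarrow> real) \<Rightarrow> real" where
  "A_KL1 r p q = (\<Sum>j=1..r. \<bar>1 + ln (p j / q j)\<bar>)"

definition A_KL2 :: "nat \<Rightarrow> (nat \<Rightarrow> real) \<Rightarrow> (nat \<Rightarrow> real) \<Rightarrow> real" where
  "A_KL2 r p q = (\<Sum>j=1..r. p j / q j)"

definition iid_sample ::
  "'w measure \<Rightarrow> nat \<Rightarrow> (nat \<Rightarrow> 'a) \<Rightarrow> (nat \<Rightarrow> real) \<Rightarrow> (nat \<Rightarrow> 'w \<Rightarrow> 'a) \<Rightarrow> bool" where
  "iid_sample M r c p X \<longleftrightarrow>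
    prob_space.indep_vars M (\<lambda>_. count_space (c ` {1..r})) X {1..} \<and>
    (\<forall>i\<ge>1. \<forall>j\<in>{1..r}. measure M {\<omega> \<in> space M. X i \<omega> = c j} = p j)"

definition indep_samples ::
  "'w measure \<Rightarrow> nat \<Rightarrow> (nat \<Rightarrow> 'a) \<Rightarrow> (nat \<Rightarrow> 'w \<Rightarrow> 'a) \<Rightarrow> (nat \<Rightarrow> 'w \<Rightarrow> 'a) \<Rightarrow> bool" where
  "indep_samples M r c X Y \<longleftrightarrow>
    prob_space.indep_var M
      (PiM {1..} (\<lambda>_. count_space (c ` {1..r}))) (\<lambda>\<omega>. \<lambda>i\<in>{1..}. X i \<omega>)
      (PiM {1..} (\<lambda>_. count_space (c ` {1..r}))) (\<lambda>\<omega>. \<lambda>i\<in>{1..}. Y i \<omega>)"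

text \<open>
  The upper limit as both indices tend to infinity is \<^const>\<open>Limsup\<close> along the product filter.
\<close>

lemma Limsup_prod_sequentially:
  fixes x :: "nat \<Rightarrow> nat \<Rightarrow> ereal"
  shows "(\<lambda>N. SUP (n, m)\<in>{N..} \<times> {N..}. x n m)
    \<longlonglongrightarrow> Limsup (sequentially \<times>\<^sub>F sequentially) (\<lambda>(n, m). x n m)"
proof -
  let ?S = "\<lambda>N. SUP (n, m)\<in>{N..} \<times> {N..}. x n m"
  have "Limsup (sequentially \<times>\<^sub>F sequentially) (\<lambda>(n, m). x n m) = (INF N. ?S N)"
    unfolding Limsup_def
  proof (rule antisym)
    show "(INF P\<in>{P. eventually P (sequentially \<times>\<^sub>F sequentially)}.
        SUP z\<in>{z. P z}. case z of (n, m) \<Rightarrow> x n m) \<le> (INF N. ?S N)"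
    proof (rule INF_greatest)
      fix N
      have "eventually (\<lambda>z. z \<in> {N..} \<times> {N..}) (sequentially \<times>\<^sub>F sequentially)"
        by (auto simp: eventually_prod_sequentially)
      then show "(INF P\<in>{P. eventually P (sequentially \<times>\<^sub>F sequentially)}.
          SUP z\<in>{z. P z}. case z of (n, m) \<Rightarrow> x n m) \<le> ?S N"
        by (intro INF_lower2[of "\<lambda>z. z \<in> {N..} \<times> {N..}"]) auto
    qed
    show "(INF N. ?S N) \<le> (INF P\<in>{P. eventually P (sequentially \<times>\<^sub>F sequentially)}.
        SUP z\<in>{z. P z}. case z of (n, m) \<Rightarrow> x n m)"
    proof (rule INF_greatest, clarify)
      fix P :: "nat \<times> nat \<Rightarrow> bool"
      assume "eventually P (sequentially \<times>\<^sub>F sequentially)"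
      then obtain N where "\<forall>m\<ge>N. \<forall>n\<ge>N. P (n, m)"
        by (auto simp: eventually_prod_sequentially)
      then have "?S N \<le> (SUP z\<in>{z. P z}. case z of (n, m) \<Rightarrow> x n m)"
        by (intro SUP_subset_mono) auto
      then show "(INF N. ?S N) \<le> (SUP z\<in>{z. P z}. case z of (n, m) \<Rightarrow> x n m)"
        by (rule INF_lower2[OF UNIV_I])
    qed
  qed
  moreover have "decseq ?S"
    unfolding decseq_def by (intro allI impI SUP_subset_mono) auto
  ultimately show ?thesis
    using LIMSEQ_INF[of ?S] by simp
qed

end

theory Submission
  imports Defs
begin

text \<open>
  By Hoeffding's inequality and the Borel--Cantelli lemma the empirical probabilities converge
  almost surely. On this event the claim is deterministic. Each summand of the divergence
  satisfies
  \<open>u ln (u / v) - s ln (s / t) = (h u - h s) - u (ln v - ln t)\<close> with \<open>h x = x ln (x / t)\<close>, so the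
  first-order expansions of \<open>h\<close> at \<open>s\<close> and of \<open>ln\<close> at \<open>t\<close> bound it by
  \<open>(\<bar>1 + ln (s / t)\<bar> + e) \<bar>u - s\<bar> + (s / t + e) \<bar>v - t\<bar>\<close> near \<open>(s, t)\<close>. The one-sample bounds are
  the cases in which one of the two arguments is constant.
\<close>

section \<open>Almost sure convergence of empirical probabilities\<close>

text \<open>For a fixed threshold, the probabilities of large deviations decay geometrically in n
  and are therefore summable, so almost surely only finitely many of these deviations occur.\<close>

lemma (in prob_space) bounded_strong_law:
  fixes Z :: "nat \<Rightarrow> 'a \<Rightarrow> real"
  assumes indep: "indep_vars (\<lambda>_. borel) Z {1..}"
    and bnd: "\<And>i. i \<ge> 1 \<Longrightarrow> AE x in M. Z i x \<in> {a..b}" and ab: "a < b"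
    and mean: "\<And>i. i \<ge> 1 \<Longrightarrow> expectation (Z i) = \<mu>"
  shows "AE x in M. (\<lambda>n. (\<Sum>i=1..n. Z i x) / real n) \<longlonglongrightarrow> \<mu>"
proof -
  have meas [measurable]: "random_variable borel (Z i)" if "i \<ge> 1" for i
    using indep that by (auto simp: indep_vars_def)
  have deviation: "AE x in M. \<forall>\<^sub>F n in sequentially. \<bar>(\<Sum>i=1..n. Z i x) - real n * \<mu>\<bar> < real n * e"
    if e: "e > 0" for e
  proof -
    define A where "A n = {x \<in> space M. \<bar>(\<Sum>i=1..n. Z i x) - real n * \<mu>\<bar> \<ge> real n * e}" for n
    \<comment> \<open>Hoeffding's exponent for n variables of range \<open>b - a\<close> and
      deviation \<open>n * e\<close> is linear in n, because the factor n in the sum of squared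
      ranges cancels one of the two in \<open>(n * e)\<^sup>2\<close>. Hence the bound is
      \<open>2 * \<rho> ^ n\<close>.\<close>
    define \<rho> where "\<rho> = exp (- 2 * e\<^sup>2 / (b - a)\<^sup>2)"
    have [measurable]: "A n \<in> events" for n
    proof -
      have [measurable]: "(\<lambda>x. \<Sum>i=1..n. Z i x) \<in> borel_measurable M"
        by (intro borel_measurable_sum meas) auto
      show ?thesis unfolding A_def by measurable
    qed
    have prob_A: "prob (A n) \<le> 2 * \<rho> ^ n" for n
    \<comment> \<open>For n = 0 the sum of squared ranges in Hoeffding's exponent vanishes; the
      claimed bound is then 2, which is trivial.\<close>
    proof (cases "n = 0")
      case True
      have "prob (A n) \<le> 1" by (rule prob_le_1)
      then show ?thesis using True by (simp add: order_trans[of _ 1 2])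
    next
      case False
      interpret Hoeffding_ineq M "{1..n}" Z "\<lambda>_. a" "\<lambda>_. b" "\<Sum>i=1..n. expectation (Z i)"
        by unfold_locales (use bnd in \<open>auto intro!: indep_vars_subset[OF indep]\<close>)
      have "prob {x \<in> space M. \<bar>(\<Sum>i=1..n. Z i x) - (\<Sum>i=1..n. expectation (Z i))\<bar> \<ge> real n * e}
          \<le> 2 * exp (-2 * (real n * e)\<^sup>2 / (\<Sum>i=1..n. (b - a)\<^sup>2))"
        by (rule Hoeffding_ineq_abs_ge) (use e ab False in auto)
      also have "-2 * (real n * e)\<^sup>2 / (\<Sum>i=1..n. (b - a)\<^sup>2) = real n * (- 2 * e\<^sup>2 / (b - a)\<^sup>2)"
        using False by (simp add: power2_eq_square)
      also have "exp (real n * (- 2 * e\<^sup>2 / (b - a)\<^sup>2)) = \<rho> ^ n"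
        unfolding \<rho>_def by (rule exp_of_nat_mult)
      finally show ?thesis
        by (simp add: A_def mean)
    qed
    have "norm \<rho> < 1"
      using e ab by (simp add: \<rho>_def)
    then have "summable (\<lambda>n. 2 * \<rho> ^ n)"
      by (intro summable_mult summable_geometric)
    then have "summable (\<lambda>n. prob (A n))"
      by (rule summable_comparison_test') (use prob_A in simp)
    then have "AE x in M. \<forall>\<^sub>F n in sequentially. x \<in> space M - A n"
      by (intro borel_cantelli_AE1) (auto simp: emeasure_eq_measure)
    then show ?thesis
      by (rule eventually_mono) (auto simp: A_def elim!: eventually_mono)
  qed
  \<comment> \<open>The exceptional null set depends on the threshold, so only the countably many
    values 1 / (k + 1) are used.\<close>
  have "AE x in M. \<forall>k. \<forall>\<^sub>F n in sequentially.
      \<bar>(\<Sum>i=1..n. Z i x) - real n * \<mu>\<bar> < real n * (1 / real (Suc k))"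
    by (intro AE_all_countable[THEN iffD2] allI deviation) simp
  then show ?thesis
  proof (rule eventually_mono)
    fix x
    assume *: "\<forall>k. \<forall>\<^sub>F n in sequentially.
      \<bar>(\<Sum>i=1..n. Z i x) - real n * \<mu>\<bar> < real n * (1 / real (Suc k))"
    show "(\<lambda>n. (\<Sum>i=1..n. Z i x) / real n) \<longlonglongrightarrow> \<mu>"
    proof (rule tendstoI)
      fix e :: real assume "e > 0"
      then obtain k where k: "1 / real (Suc k) < e"
        using nat_approx_posE by blast
      show "\<forall>\<^sub>F n in sequentially. dist ((\<Sum>i=1..n. Z i x) / real n) \<mu> < e"
        using *[rule_format, of k] eventually_gt_at_top[of 0]
      proof eventually_elim
        case (elim n)
        have "(\<Sum>i=1..n. Z i x) / real n - \<mu> = ((\<Sum>i=1..n. Z i x) - real n * \<mu>) / real n"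
          using elim(2) by (simp add: diff_divide_distrib)
        then have "dist ((\<Sum>i=1..n. Z i x) / real n) \<mu> = \<bar>(\<Sum>i=1..n. Z i x) - real n * \<mu>\<bar> / real n"
          by (simp add: dist_real_def abs_divide)
        also have "\<dots> < 1 / real (Suc k)"
          using elim by (simp only: pos_divide_less_eq of_nat_0_less_iff mult.commute)
        finally show ?case using k by simp
      qed
    qed
  qed
qed

text \<open>An empirical probability is the average of independent indicators with values in [0, 1]
  and mean \<open>p j\<close>. There are finitely many \<open>j\<close>, so one null set serves them
  all.\<close>

lemma AE_emp_prob_tendsto:
  assumes "prob_space M" and iid: "iid_sample M r c p X"
  shows "AE \<omega> in M. \<forall>j\<in>{1..r}. (\<lambda>n. emp_prob c X n \<omega> j) \<longlonglongrightarrow> p j"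
proof (rule AE_finite_allI)
  interpret prob_space M by fact
  fix j assume j: "j \<in> {1..r}"
  let ?Z = "\<lambda>i \<omega>. indicator {c j} (X i \<omega>) :: real"
  have indep: "indep_vars (\<lambda>_. count_space (c ` {1..r})) X {1..}"
    and prob: "\<And>i. i \<ge> 1 \<Longrightarrow> prob {\<omega> \<in> space M. X i \<omega> = c j} = p j"
    using iid j by (auto simp: iid_sample_def)
  have "AE \<omega> in M. (\<lambda>n. (\<Sum>i=1..n. ?Z i \<omega>) / real n) \<longlonglongrightarrow> p j"
  proof (rule bounded_strong_law[where a = 0 and b = 1])
    show indep_Z: "indep_vars (\<lambda>_. borel) ?Z {1..}"
      by (rule indep_vars_compose2[OF indep]) simp
    fix i :: nat assume i: "i \<ge> 1"
    have [measurable]: "random_variable (count_space (c ` {1..r})) (X i)"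
      using indep i by (auto simp: indep_vars_def)
    have "expectation (?Z i) = expectation (indicator {\<omega> \<in> space M. X i \<omega> = c j})"
      by (intro Bochner_Integration.integral_cong) (auto simp: indicator_def)
    also have "\<dots> = p j"
      using prob[OF i] by (simp add: Int_def conj_commute)
    finally show "expectation (?Z i) = p j" .
  qed (auto simp: indicator_def)
  then show "AE \<omega> in M. (\<lambda>n. emp_prob c X n \<omega> j) \<longlonglongrightarrow> p j"
    by (simp add: emp_prob_def indicator_def)
qed simp

section \<open>First-order bounds for the divergence\<close>

lemma DERIV_eventually_abs_diff_le:
  fixes f :: "real \<Rightarrow> real"
  assumes f: "(f has_real_derivative D) (at x)" and e: "e > 0" and u: "(u \<longlongrightarrow> x) F"
  shows "\<forall>\<^sub>F i in F. \<bar>f (u i) - f x\<bar> \<le> (\<bar>D\<bar> + e) * \<bar>u i - x\<bar>"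
proof -
  have "((\<lambda>y. \<bar>(f y - f x) / (y - x)\<bar>) \<longlongrightarrow> \<bar>D\<bar>) (at x)"
    using f by (intro tendsto_rabs) (simp add: has_field_derivative_iff)
  then have "\<forall>\<^sub>F y in at x. \<bar>(f y - f x) / (y - x)\<bar> < \<bar>D\<bar> + e"
    by (rule order_tendstoD) (use e in simp)
  \<comment> \<open>Multiplying out the quotient makes the bound hold at \<open>y = x\<close> as
    well, so \<open>u\<close> may take the value \<open>x\<close>, as it does when it is
    constant.\<close>
  then have "\<forall>\<^sub>F y in nhds x. \<bar>f y - f x\<bar> \<le> (\<bar>D\<bar> + e) * \<bar>y - x\<bar>"
    unfolding eventually_at_filter
    by (rule eventually_mono) (use e in \<open>auto simp: abs_divide pos_divide_less_eq\<close>)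
  then show ?thesis
    using u by (rule eventually_compose_filterlim)
qed

lemma eventually_kl_summand_diff_le:
  fixes s t e :: real
  assumes pos: "s > 0" "t > 0" "e > 0"
    and u: "(u \<longlongrightarrow> s) F" and v: "(v \<longlongrightarrow> t) F"
  shows "\<forall>\<^sub>F i in F. \<bar>u i * ln (u i / v i) - s * ln (s / t)\<bar>
           \<le> (\<bar>1 + ln (s / t)\<bar> + e) * \<bar>u i - s\<bar> + (s / t + e) * \<bar>v i - t\<bar>"
proof -
  \<comment> \<open>With this choice \<open>s * (1 / t + d)\<close> equals
    \<open>s / t + e / 2\<close>. The remaining \<open>e / 2\<close> absorbs the replacement of the
    limit \<open>s\<close> by \<open>u i\<close>.\<close>
  define d where "d = e / (2 * s)"
  have d: "d > 0" using pos by (simp add: d_def)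
  have "((\<lambda>x. x * ln (x / t)) has_real_derivative 1 + ln (s / t)) (at s)"
    using pos by (auto intro!: derivative_eq_intros simp: field_simps)
  from DERIV_eventually_abs_diff_le[OF this pos(3) u]
  have 1: "\<forall>\<^sub>F i in F. \<bar>u i * ln (u i / t) - s * ln (s / t)\<bar> \<le> (\<bar>1 + ln (s / t)\<bar> + e) * \<bar>u i - s\<bar>" .
  have 2: "\<forall>\<^sub>F i in F. \<bar>ln (v i) - ln t\<bar> \<le> (\<bar>1 / t\<bar> + d) * \<bar>v i - t\<bar>"
    using pos by (intro DERIV_eventually_abs_diff_le v d) (auto intro!: derivative_eq_intros)
  have "((\<lambda>i. u i * (1 / t + d)) \<longlongrightarrow> s * (1 / t + d)) F"
    by (intro tendsto_intros u)
  moreover have "s * (1 / t + d) < s / t + e"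
    using pos by (simp add: d_def field_simps)
  ultimately have 3: "\<forall>\<^sub>F i in F. u i * (1 / t + d) < s / t + e"
    by (rule order_tendstoD)
  show ?thesis
    using 1 2 3 order_tendstoD(1)[OF u pos(1)] order_tendstoD(1)[OF v pos(2)]
  proof eventually_elim
    case (elim i)
    have "u i * ln (u i / v i) - s * ln (s / t)
        = (u i * ln (u i / t) - s * ln (s / t)) - u i * (ln (v i) - ln t)"
      using elim pos by (simp add: ln_div algebra_simps)
    also have "\<bar>\<dots>\<bar> \<le> \<bar>u i * ln (u i / t) - s * ln (s / t)\<bar> + u i * \<bar>ln (v i) - ln t\<bar>"
      using elim by (intro order_trans[OF abs_triangle_ineq4]) (simp add: abs_mult)
    also have "u i * \<bar>ln (v i) - ln t\<bar> \<le> u i * ((1 / t + d) * \<bar>v i - t\<bar>)"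
      using elim pos by (intro mult_left_mono) auto
    also have "\<dots> = (u i * (1 / t + d)) * \<bar>v i - t\<bar>"
      by simp
    also have "\<dots> \<le> (s / t + e) * \<bar>v i - t\<bar>"
      using elim by (intro mult_right_mono) auto
    finally show ?case using elim(1) by linarith
  qed
qed

lemma abs_diff_le_sup_dev: "j \<in> {1..r} \<Longrightarrow> \<bar>u j - v j\<bar> \<le> sup_dev r u v"
  unfolding sup_dev_def by (rule cSUP_upper) auto

lemma sup_dev_nonneg: "r \<ge> 1 \<Longrightarrow> 0 \<le> sup_dev r u v"
  using abs_diff_le_sup_dev[of 1 r u v] by auto

lemma sup_dev_self: "r \<ge> 1 \<Longrightarrow> sup_dev r u u = 0"
  by (simp add: sup_dev_def)

text \<open>Each of the r summands gets slack \<open>e / r\<close>, so the slopes add up to the two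
  constants, each enlarged by \<open>e\<close>. A general filter \<open>F\<close> covers both a
  single index and pairs of indices.\<close>

lemma eventually_kl_div_diff_le:
  fixes r :: nat and p q :: "nat \<Rightarrow> real"
  assumes r: "r \<ge> 1" and p: "\<forall>j\<in>{1..r}. p j > 0" and q: "\<forall>j\<in>{1..r}. q j > 0" and e: "e > 0"
    and u: "\<forall>j\<in>{1..r}. ((\<lambda>i. u i j) \<longlongrightarrow> p j) F" and v: "\<forall>j\<in>{1..r}. ((\<lambda>i. v i j) \<longlongrightarrow> q j) F"
  shows "\<forall>\<^sub>F i in F. \<bar>kl_div r (u i) (v i) - kl_div r p q\<bar>
           \<le> (A_KL1 r p q + e) * sup_dev r (u i) p + (A_KL2 r p q + e) * sup_dev r (v i) q"
proof -
  \<comment> \<open>Positivity is carried along to keep \<open>kl_div\<close> out of its default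
    branch: the limits are positive, so all entries are eventually positive.\<close>
  have "\<forall>\<^sub>F i in F. \<forall>j\<in>{1..r}. u i j > 0 \<and> v i j > 0 \<and>
      \<bar>u i j * ln (u i j / v i j) - p j * ln (p j / q j)\<bar>
        \<le> (\<bar>1 + ln (p j / q j)\<bar> + e / r) * \<bar>u i j - p j\<bar> + (p j / q j + e / r) * \<bar>v i j - q j\<bar>"
  proof (intro eventually_ball_finite ballI eventually_conj)
    fix j assume j: "j \<in> {1..r}"
    show "\<forall>\<^sub>F i in F. u i j > 0" "\<forall>\<^sub>F i in F. v i j > 0"
      using j p q u v order_tendstoD(1) by blast+
    show "\<forall>\<^sub>F i in F. \<bar>u i j * ln (u i j / v i j) - p j * ln (p j / q j)\<bar>
        \<le> (\<bar>1 + ln (p j / q j)\<bar> + e / r) * \<bar>u i j - p j\<bar> + (p j / q j + e / r) * \<bar>v i j - q j\<bar>"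
      using j p q u v e r by (intro eventually_kl_summand_diff_le) auto
  qed simp
  then show ?thesis
  proof eventually_elim
    case (elim i)
    let ?a = "sup_dev r (u i) p" and ?b = "sup_dev r (v i) q"
    have "\<bar>kl_div r (u i) (v i) - kl_div r p q\<bar>
        = \<bar>\<Sum>j=1..r. u i j * ln (u i j / v i j) - p j * ln (p j / q j)\<bar>"
      using elim p q by (simp add: kl_div_def sum_subtractf)
    also have "\<dots> \<le> (\<Sum>j=1..r. (\<bar>1 + ln (p j / q j)\<bar> + e / r) * ?a + (p j / q j + e / r) * ?b)"
    proof (intro sum_abs[THEN order_trans] sum_mono)
      fix j assume j: "j \<in> {1..r}"
      then have "0 \<le> p j / q j" using p q by (simp add: less_imp_le)
      then have "(\<bar>1 + ln (p j / q j)\<bar> + e / r) * \<bar>u i j - p j\<bar> + (p j / q j + e / r) * \<bar>v i j - q j\<bar>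
          \<le> (\<bar>1 + ln (p j / q j)\<bar> + e / r) * ?a + (p j / q j + e / r) * ?b"
        using e j by (intro add_mono mult_left_mono abs_diff_le_sup_dev) auto
      with elim j show "\<bar>u i j * ln (u i j / v i j) - p j * ln (p j / q j)\<bar> \<le> \<dots>"
        by force
    qed
    also have "\<dots> = (A_KL1 r p q + e) * ?a + (A_KL2 r p q + e) * ?b"
      using r by (simp add: A_KL1_def A_KL2_def sum.distrib flip: sum_distrib_right)
    finally show ?case .
  qed
qed

section \<open>From eventual bounds to upper limits\<close>

text \<open>Each \<open>e > 0\<close> bounds the upper limit by \<open>C + e\<close>, and
  \<open>e\<close> is arbitrary. The hypothesis is a product bound, which also makes sense where
  \<open>g\<close> vanishes.\<close>

lemma Limsup_ratio_le:
  fixes f g :: "'i \<Rightarrow> real"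
  assumes "C \<ge> 0" and g: "\<And>i. g i \<ge> 0"
    and le: "\<And>e. e > 0 \<Longrightarrow> \<forall>\<^sub>F i in F. f i \<le> (C + e) * g i"
  shows "Limsup F (\<lambda>i. ereal (f i / g i)) \<le> ereal C"
proof (rule ereal_le_epsilon2)
  fix e :: real assume e: "e > 0"
  have "\<forall>\<^sub>F i in F. ereal (f i / g i) \<le> ereal (C + e)"
    using le[OF e]
  proof eventually_elim
    case (elim i)
    then show ?case
      \<comment> \<open>Where \<open>g i = 0\<close>, division by zero yields 0, in accordance with
        the convention for 0/0, and 0 is at most \<open>C + e\<close>.\<close>
      using g[of i] assms(1) e by (cases "g i = 0") (auto simp: pos_divide_le_eq)
  qed
  then show "Limsup F (\<lambda>i. ereal (f i / g i)) \<le> ereal C + ereal e"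
    by (simp add: Limsup_bounded)
qed

theorem corollary9:
  fixes M :: "'w measure" and r :: nat and c :: "nat \<Rightarrow> 'a"
    and p q :: "nat \<Rightarrow> real" and X Y :: "nat \<Rightarrow> 'w \<Rightarrow> 'a"
  assumes "prob_space M"
    and "r \<ge> 2" and "inj_on c {1..r}"
    and "prob_vector r p" and "prob_vector r q"
    and "\<forall>j\<in>{1..r}. p j > 0" and "\<forall>j\<in>{1..r}. q j > 0"
    and "iid_sample M r c p X" and "iid_sample M r c q Y"
    and "indep_samples M r c X Y"
  defines "a \<equiv> \<lambda>n \<omega>. sup_dev r (emp_prob c X n \<omega>) p"
    and "b \<equiv> \<lambda>m \<omega>. sup_dev r (emp_prob c Y m \<omega>) q"
  shows
    "(AE \<omega> in M.
        limsup (\<lambda>n. ereal (\<bar>kl_div r (emp_prob c X n \<omega>) q - kl_div r p q\<bar> / a n \<omega>))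
          \<le> ereal (A_KL1 r p q)) \<and>
     (AE \<omega> in M.
        limsup (\<lambda>n. ereal (\<bar>kl_div r p (emp_prob c Y n \<omega>) - kl_div r p q\<bar> / b n \<omega>))
          \<le> ereal (A_KL2 r p q)) \<and>
     (AE \<omega> in M.
        Limsup (sequentially \<times>\<^sub>F sequentially)
          (\<lambda>(n, m). ereal (\<bar>kl_div r (emp_prob c X n \<omega>) (emp_prob c Y m \<omega>) - kl_div r p q\<bar>
                            / max (a n \<omega>) (b m \<omega>)))
          \<le> ereal (A_KL1 r p q + A_KL2 r p q))"
proof -
  have r: "r \<ge> 1" using assms(2) by simp
  note pos = assms(6,7)
  have A1: "A_KL1 r p q \<ge> 0" and A2: "A_KL2 r p q \<ge> 0"
    using pos by (auto simp: A_KL1_def A_KL2_def less_imp_le intro!: sum_nonneg)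
  have a0: "a n \<omega> \<ge> 0" and b0: "b n \<omega> \<ge> 0" for n \<omega>
    unfolding a_def b_def by (intro sup_dev_nonneg r)+
  have X: "AE \<omega> in M. \<forall>j\<in>{1..r}. (\<lambda>n. emp_prob c X n \<omega> j) \<longlonglongrightarrow> p j"
    and Y: "AE \<omega> in M. \<forall>j\<in>{1..r}. (\<lambda>n. emp_prob c Y n \<omega> j) \<longlonglongrightarrow> q j"
    using AE_emp_prob_tendsto assms(1,8,9) by blast+
  have "AE \<omega> in M.
      limsup (\<lambda>n. ereal (\<bar>kl_div r (emp_prob c X n \<omega>) q - kl_div r p q\<bar> / a n \<omega>))
        \<le> ereal (A_KL1 r p q)"
    using X
  proof (rule eventually_mono)
    fix \<omega> assume lim: "\<forall>j\<in>{1..r}. (\<lambda>n. emp_prob c X n \<omega> j) \<longlonglongrightarrow> p j"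
    show "limsup (\<lambda>n. ereal (\<bar>kl_div r (emp_prob c X n \<omega>) q - kl_div r p q\<bar> / a n \<omega>))
        \<le> ereal (A_KL1 r p q)"
    proof (rule Limsup_ratio_le[OF A1 a0])
      fix e :: real assume "e > 0"
      \<comment> \<open>The constant second argument has deviation 0 from \<open>q\<close>, so only
        the term with \<open>A_KL1\<close> survives.\<close>
      from eventually_kl_div_diff_le[OF r pos this lim, of "\<lambda>_. q"]
      show "\<forall>\<^sub>F n in sequentially. \<bar>kl_div r (emp_prob c X n \<omega>) q - kl_div r p q\<bar>
          \<le> (A_KL1 r p q + e) * a n \<omega>"
        by (simp add: sup_dev_self[OF r] a_def)
    qed
  qed
  moreover have "AE \<omega> in M.
      limsup (\<lambda>n. ereal (\<bar>kl_div r p (emp_prob c Y n \<omega>) - kl_div r p q\<bar> / b n \<omega>))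
        \<le> ereal (A_KL2 r p q)"
    using Y
  proof (rule eventually_mono)
    fix \<omega> assume lim: "\<forall>j\<in>{1..r}. (\<lambda>n. emp_prob c Y n \<omega> j) \<longlonglongrightarrow> q j"
    show "limsup (\<lambda>n. ereal (\<bar>kl_div r p (emp_prob c Y n \<omega>) - kl_div r p q\<bar> / b n \<omega>))
        \<le> ereal (A_KL2 r p q)"
    proof (rule Limsup_ratio_le[OF A2 b0])
      fix e :: real assume "e > 0"
      \<comment> \<open>Here the first argument is constant, which leaves the term with
        \<open>A_KL2\<close>.\<close>
      from eventually_kl_div_diff_le[OF r pos this _ lim, of "\<lambda>_. p"]
      show "\<forall>\<^sub>F n in sequentially. \<bar>kl_div r p (emp_prob c Y n \<omega>) - kl_div r p q\<bar>
          \<le> (A_KL2 r p q + e) * b n \<omega>"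
        by (simp add: sup_dev_self[OF r] b_def)
    qed
  qed
  moreover have "AE \<omega> in M.
      Limsup (sequentially \<times>\<^sub>F sequentially)
        (\<lambda>(n, m). ereal (\<bar>kl_div r (emp_prob c X n \<omega>) (emp_prob c Y m \<omega>) - kl_div r p q\<bar>
                          / max (a n \<omega>) (b m \<omega>)))
        \<le> ereal (A_KL1 r p q + A_KL2 r p q)"
    using X Y
  proof eventually_elim
    case (elim \<omega>)
    let ?u = "\<lambda>z. emp_prob c X (fst z) \<omega>" and ?v = "\<lambda>z. emp_prob c Y (snd z) \<omega>"
    let ?c = "\<lambda>z. max (a (fst z) \<omega>) (b (snd z) \<omega>)"
    have "Limsup (sequentially \<times>\<^sub>F sequentially)
        (\<lambda>z. ereal (\<bar>kl_div r (?u z) (?v z) - kl_div r p q\<bar> / ?c z))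
        \<le> ereal (A_KL1 r p q + A_KL2 r p q)"
    proof (rule Limsup_ratio_le)
      fix e :: real assume e: "e > 0"
      \<comment> \<open>Each sequence depends on one coordinate of the pair, and the projections
        carry the product filter to \<open>sequentially\<close>.\<close>
      have "\<forall>j\<in>{1..r}. ((\<lambda>z. ?u z j) \<longlongrightarrow> p j) (sequentially \<times>\<^sub>F sequentially)"
        using elim(1) filterlim_compose filterlim_fst by blast
      moreover have "\<forall>j\<in>{1..r}. ((\<lambda>z. ?v z j) \<longlongrightarrow> q j) (sequentially \<times>\<^sub>F sequentially)"
        using elim(2) filterlim_compose filterlim_snd by blast
      \<comment> \<open>The slack is halved because bounding both deviations by their maximum adds
        the two coefficients.\<close>
      moreover have "e / 2 > 0" using e by simp
      ultimately have "\<forall>\<^sub>F z in sequentially \<times>\<^sub>F sequentially.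
          \<bar>kl_div r (?u z) (?v z) - kl_div r p q\<bar>
            \<le> (A_KL1 r p q + e / 2) * a (fst z) \<omega> + (A_KL2 r p q + e / 2) * b (snd z) \<omega>"
        unfolding a_def b_def by (intro eventually_kl_div_diff_le r pos)
      then show "\<forall>\<^sub>F z in sequentially \<times>\<^sub>F sequentially.
          \<bar>kl_div r (?u z) (?v z) - kl_div r p q\<bar> \<le> (A_KL1 r p q + A_KL2 r p q + e) * ?c z"
      proof eventually_elim
        case (elim z)
        have "(A_KL1 r p q + e / 2) * a (fst z) \<omega> + (A_KL2 r p q + e / 2) * b (snd z) \<omega>
            \<le> (A_KL1 r p q + e / 2) * ?c z + (A_KL2 r p q + e / 2) * ?c z"
          using A1 A2 e by (intro add_mono mult_left_mono) auto
        also have "\<dots> = (A_KL1 r p q + A_KL2 r p q + e) * ?c z"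
          by (simp add: algebra_simps)
        finally show ?case using elim by linarith
      qed
    qed (use A1 A2 a0 in \<open>auto simp: le_max_iff_disj\<close>)
    then show ?case
      by (simp add: case_prod_unfold)
  qed
  ultimately show ?thesis by blast
qed

end
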